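(* Let $s$ be a positive integer. Then there are infinitely many square numbers $N$ for which there exist square numbers $u$ and $v$, neither of which is divisible by $10$, such that $N$ is constructed by putting $s$ zeros between $u$ and $v$, i.e. $N = u\cdot 10^{m+s}+v$, where $m$ is the number of decimal digits of $v$.
   Context: A square number is an integer of the form $n^2$ with $n$ a positive integer. A number $N$ is "constructed by putting $s$ zeros between two square numbers $u$ and $v$" if the decimal expansion of $N$ is the decimal expansion of $u$, followed by $s$ digits equal to $0$, followed by the decimal expansion of $v$, i.e. $N=u\cdot 10^{m+s}+v$, where $m$ is the number of decimal digits of $v$. *)

theory Defs
  imports Complex_Main "HOL-Library.Log_Nat"
begin

definition square_number :: "nat \<Rightarrow> bool" where
  "square_number N \<longleftrightarrow> (\<exists>n>0. N = n ^ 2)"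

text \<open>For positive \<open>v\<close>, \<open>floorlog 10 v\<close> is the number of decimal digits of \<open>v\<close>.\<close>

definition put_zeros_between :: "nat \<Rightarrow> nat \<Rightarrow> nat \<Rightarrow> nat" where
  "put_zeros_between s u v = u * 10 ^ (floorlog 10 v + s) + v"

end

theory Submission
  imports Defs "HOL-Library.Infinite_Set" "HOL-Computational_Algebra.Primes"
begin

text \<open>
  Let \<open>v = b\<^sup>2\<close> have \<open>m\<close> digits. The condition \<open>c\<^sup>2 = a\<^sup>2 \<cdot> 10\<^bsup>m+s\<^esup> + b\<^sup>2\<close> is a
  generalised Pell equation in \<open>c\<close> and \<open>a\<close> when \<open>m + s\<close> is odd, and it is solved by
  \<open>c = b x\<close>, \<open>a = b z\<close> for every solution of \<open>x\<^sup>2 = 10\<^bsup>m+s\<^esup> z\<^sup>2 + 1\<close>. The choice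
  \<open>b = 1\<close> makes \<open>m + s\<close> odd for even \<open>s\<close>, and \<open>b = 7\<close> does so for odd \<open>s\<close>, because 49 has
  two digits. It remains to find arbitrarily large solutions of the Pell equation
  in which \<open>10\<close> does not divide \<open>z\<close>; those found here have \<open>z\<close> prime to \<open>5\<close>.

  A solution for the exponent \<open>2 j + 3\<close> is the same as one for \<open>2 j + 1\<close> whose second
  component is divisible by \<open>10\<close>. In the group of solutions, the fifth power of a
  solution adds exactly one factor of \<open>5\<close> to the second component
  (\<open>pell_fifth_power\<close>), and the square adds a factor of \<open>2\<close> but none of \<open>5\<close>
  (\<open>pell_square\<close>). Hence the tenth power raises the exponent by two
  (\<open>pell_odd_power_of_10\<close>), starting from \<open>19\<^sup>2 = 10 \<cdot> 6\<^sup>2 + 1\<close>, and further squaring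
  makes the solution arbitrarily large (\<open>pell_odd_power_of_10_unbounded\<close>).
\<close>

text \<open>
  These are the components of \<open>(x + z \<surd>D)\<^sup>2\<close>. Since \<open>x\<^sup>2\<close> is \<open>1\<close> modulo \<open>D\<close>
  and \<open>5\<close> divides \<open>D\<close>, the new factor \<open>2 x\<close> is prime to \<open>5\<close>.
\<close>
lemma pell_square:
  fixes D x z :: nat
  assumes pell: "x\<^sup>2 = D * z\<^sup>2 + 1" and "5 dvd D" and "\<not> 5 dvd z"
  shows "(2 * D * z\<^sup>2 + 1)\<^sup>2 = D * (2 * x * z)\<^sup>2 + 1"
    and "\<not> 5 dvd 2 * x * z"
proof -
  have "(2 * D * z\<^sup>2 + 1)\<^sup>2 = 4 * (D * z\<^sup>2) * (D * z\<^sup>2 + 1) + 1"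
    by (simp add: power2_eq_square algebra_simps)
  also have "\<dots> = D * (2 * x * z)\<^sup>2 + 1"
    unfolding pell[symmetric] by (simp add: power_mult_distrib)
  finally show "(2 * D * z\<^sup>2 + 1)\<^sup>2 = D * (2 * x * z)\<^sup>2 + 1" .
next
  have prime5: "prime (5::nat)" by simp
  have "\<not> 5 dvd x"
  proof
    assume "5 dvd x"
    then have "5 dvd D * z\<^sup>2 + 1"
      unfolding pell[symmetric] by (simp add: power2_eq_square)
    moreover have "5 dvd D * z\<^sup>2"
      using \<open>5 dvd D\<close> by simp
    ultimately show False by presburger
  qed
  then show "\<not> 5 dvd 2 * x * z"
    using \<open>\<not> 5 dvd z\<close> by (simp add: prime_dvd_mult_iff[OF prime5])
qed

text \<open>
  With \<open>F = E z\<^sup>2\<close>, so that \<open>x\<^sup>2 = 10 F + 1\<close>, these are the components of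
  \<open>(x + z \<surd>D)\<^sup>5\<close> for \<open>D = 10 E\<close>. The second one is \<open>z (5 x\<^sup>4 + 10 x\<^sup>2 D z\<^sup>2 + D\<^sup>2 z\<^sup>4)\<close>,
  where \<open>25\<close> divides \<open>10 D\<close> and \<open>D\<^sup>2\<close>, while \<open>5 x\<^sup>4\<close> contains \<open>5\<close> only once because
  \<open>x\<^sup>2\<close> is \<open>1\<close> modulo \<open>5\<close>. So exactly one factor of \<open>5\<close> is added to those of \<open>z\<close>.
\<close>
lemma pell_fifth_power:
  fixes E F x z :: nat
  assumes pell: "x\<^sup>2 = 10 * E * z\<^sup>2 + 1" and F: "F = E * z\<^sup>2" and "\<not> 5 dvd z"
  shows "(x * (1600 * F\<^sup>2 + 120 * F + 1))\<^sup>2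
           = 10 * E * (5 * (z * (320 * F\<^sup>2 + 40 * F + 1)))\<^sup>2 + 1"
    and "\<not> 5 dvd z * (320 * F\<^sup>2 + 40 * F + 1)"
proof -
  have "(x * (1600 * F\<^sup>2 + 120 * F + 1))\<^sup>2 = (10 * F + 1) * (1600 * F\<^sup>2 + 120 * F + 1)\<^sup>2"
    by (simp only: power_mult_distrib pell F mult.assoc)
  also have "\<dots> = 10 * F * (5 * (320 * F\<^sup>2 + 40 * F + 1))\<^sup>2 + 1"
    by (simp add: power2_eq_square algebra_simps)
  also have "\<dots> = 10 * E * (5 * (z * (320 * F\<^sup>2 + 40 * F + 1)))\<^sup>2 + 1"
    by (simp only: power_mult_distrib F mult_ac)
  finally show "(x * (1600 * F\<^sup>2 + 120 * F + 1))\<^sup>2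
           = 10 * E * (5 * (z * (320 * F\<^sup>2 + 40 * F + 1)))\<^sup>2 + 1" .
next
  have prime5: "prime (5::nat)" by simp
  have "\<not> 5 dvd 320 * F\<^sup>2 + 40 * F + 1" by presburger
  then show "\<not> 5 dvd z * (320 * F\<^sup>2 + 40 * F + 1)"
    using \<open>\<not> 5 dvd z\<close> by (simp only: prime_dvd_mult_iff[OF prime5]) simp
qed

lemma pell_odd_power_of_10:
  "\<exists>x z :: nat. x\<^sup>2 = 10 ^ (2 * j + 1) * z\<^sup>2 + 1 \<and> \<not> 5 dvd z"
proof (induction j)
  case 0
  have "(19::nat)\<^sup>2 = 10 ^ (2 * 0 + 1) * 6\<^sup>2 + 1 \<and> \<not> 5 dvd (6::nat)" by simp
  then show ?case by blast
next
  case (Suc j)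
  then obtain x z :: nat
    where pell: "x\<^sup>2 = 10 * 10 ^ (2 * j) * z\<^sup>2 + 1" and z: "\<not> 5 dvd z"
    by auto
  obtain x5 z5 :: nat
    where pell5: "x5\<^sup>2 = 10 * 10 ^ (2 * j) * (5 * z5)\<^sup>2 + 1" and z5: "\<not> 5 dvd z5"
    using pell_fifth_power[OF pell refl z] by blast
  \<comment> \<open>Squaring is applied with the factor \<open>5\<close> moved from \<open>5 z\<^sub>5\<close> into the coefficient.\<close>
  define D where "D = 10 * 10 ^ (2 * j) * (25::nat)"
  have pellD: "x5\<^sup>2 = D * z5\<^sup>2 + 1"
    using pell5 by (simp add: D_def power_mult_distrib)
  have "5 dvd D" by (simp add: D_def)
  have "(2 * D * z5\<^sup>2 + 1)\<^sup>2 = 10 ^ (2 * Suc j + 1) * (x5 * z5)\<^sup>2 + 1"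
    unfolding pell_square(1)[OF pellD \<open>5 dvd D\<close> z5]
    by (simp add: D_def power_mult_distrib)
  moreover have "\<not> 5 dvd x5 * z5"
    using pell_square(2)[OF pellD \<open>5 dvd D\<close> z5] by (metis dvd_mult mult.assoc)
  ultimately show ?case by blast
qed

lemma pell_odd_power_of_10_unbounded:
  "\<exists>x z :: nat. x\<^sup>2 = 10 ^ (2 * j + 1) * z\<^sup>2 + 1 \<and> \<not> 5 dvd z \<and> n < z"
proof (induction n)
  case 0
  obtain x z :: nat where xz: "x\<^sup>2 = 10 ^ (2 * j + 1) * z\<^sup>2 + 1" "\<not> 5 dvd z"
    using pell_odd_power_of_10 by blast
  then have "0 < z" by (cases z) auto
  with xz show ?case by blast
next
  case (Suc n)
  then obtain x z :: nat
    where pell: "x\<^sup>2 = 10 ^ (2 * j + 1) * z\<^sup>2 + 1" and z: "\<not> 5 dvd z" and "n < z"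
    by blast
  have dvd5: "5 dvd (10::nat) ^ (2 * j + 1)" by simp
  have "0 < x" using pell by (cases x) auto
  have "Suc n < 2 * z" using \<open>n < z\<close> by simp
  also have "2 * z \<le> 2 * x * z" using \<open>0 < x\<close> by simp
  finally have "Suc n < 2 * x * z" .
  then show ?case
    using pell_square[OF pell dvd5 z] by blast
qed

text \<open>
  A Pell solution \<open>(x, z)\<close> for the exponent \<open>m + s\<close>, scaled by \<open>b\<close>, gives the square
  \<open>(b x)\<^sup>2\<close> composed of \<open>u = (b z)\<^sup>2\<close> and \<open>v = b\<^sup>2\<close>; a fixed \<open>v\<close> thus yields infinitely
  many numbers.
\<close>
lemma infinite_squares_if_odd_shift:
  fixes b s :: nat
  assumes "\<not> 5 dvd b" and "odd (floorlog 10 (b\<^sup>2) + s)"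
  shows "infinite {N. square_number N \<and>
           (\<exists>u v. square_number u \<and> square_number v \<and> \<not> 10 dvd u \<and> \<not> 10 dvd v \<and>
              N = put_zeros_between s u v)}"
  unfolding infinite_nat_iff_unbounded
proof
  fix n :: nat
  obtain j where j: "floorlog 10 (b\<^sup>2) + s = 2 * j + 1"
    using assms(2) by (elim oddE)
  obtain x z :: nat
    where pell: "x\<^sup>2 = 10 ^ (2 * j + 1) * z\<^sup>2 + 1" and z: "\<not> 5 dvd z" "n < z"
    using pell_odd_power_of_10_unbounded by blast
  have prime5: "prime (5::nat)" by simp
  have "0 < b" using assms(1) by (cases b) auto
  have "0 < x" using pell by (cases x) auto
  have "square_number ((b * x)\<^sup>2)" "square_number ((b * z)\<^sup>2)" "square_number (b\<^sup>2)"
    unfolding square_number_def using \<open>0 < b\<close> \<open>0 < x\<close> \<open>n < z\<close>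
    by (intro exI conjI; rule refl | simp)+
  moreover have "\<not> 10 dvd (b * z)\<^sup>2" "\<not> 10 dvd b\<^sup>2"
  proof -
    have ten: "(5::nat) dvd 10" by simp
    have "\<not> 5 dvd (b * z)\<^sup>2" "\<not> 5 dvd b\<^sup>2"
      using assms(1) z
      by (simp_all add: power2_eq_square prime_dvd_mult_iff[OF prime5])
    then show "\<not> 10 dvd (b * z)\<^sup>2" "\<not> 10 dvd b\<^sup>2"
      using dvd_trans[OF ten] by blast+
  qed
  moreover have "(b * x)\<^sup>2 = put_zeros_between s ((b * z)\<^sup>2) (b\<^sup>2)"
    unfolding put_zeros_between_def j power_mult_distrib pell
    by (simp add: algebra_simps)
  moreover have "n < (b * x)\<^sup>2"
  proof -
    have "n < z\<^sup>2" using z(2) by (rule less_le_trans) (simp add: power2_eq_square)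
    also have "z\<^sup>2 \<le> x\<^sup>2" unfolding pell by (intro trans_le_add1) simp
    also have "x\<^sup>2 \<le> (b * x)\<^sup>2" using \<open>0 < b\<close> by (simp add: power_mono)
    finally show ?thesis .
  qed
  ultimately show "\<exists>N>n. N \<in> {N. square_number N \<and>
           (\<exists>u v. square_number u \<and> square_number v \<and> \<not> 10 dvd u \<and> \<not> 10 dvd v \<and>
              N = put_zeros_between s u v)}"
    by blast
qed

theorem corollary2p5:
  fixes s :: nat
  assumes "s > 0"
  shows "infinite {N. square_number N \<and>
           (\<exists>u v. square_number u \<and> square_number v \<and> \<not> 10 dvd u \<and> \<not> 10 dvd v \<and>
              N = put_zeros_between s u v)}"
proof (cases "even s")
  case True
  have "floorlog 10 (1\<^sup>2) = 1" by (simp add: compute_floorlog)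
  with True show ?thesis
    by (intro infinite_squares_if_odd_shift[of 1]) auto
next
  case False
  have "floorlog 10 (7\<^sup>2) = 2" by (simp add: compute_floorlog)
  with False show ?thesis
    by (intro infinite_squares_if_odd_shift[of 7]) auto
qed

end
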